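(* Let $m\ge 15$ be odd. There exists $\varepsilon\in\{0,2\}$ such that $\hat{l}=l_0+\varepsilon$, where $l_0=2\lfloor\sqrt{m}-\frac{3}{2}\rfloor+1$.
   Context: For odd $m\ge 3$ let $\mathbb{Z}_m=\mathbb{Z}/m\mathbb{Z}$. A Cayley subset of $\mathbb{Z}_m$ is a subset $S$ with $0\notin S$, $S=-S$, generating $\mathbb{Z}_m$. $X(S)$ is the Cayley graph on $\mathbb{Z}_m$ ($x\sim y$ iff $y-x\in S$), with non-trivial eigenvalues $\mu_j(S)=\sum_{a\in S}e^{2\pi i a j/m}$ ($1\le j\le m-1$) and $\mu(S)=\max_j|\mu_j(S)|$; it is Ramanujan if $\mu(S)\le 2\sqrt{|S|-1}$. The covalency is $l(S)=m-|S|$. $\hat{l}$ is the largest covalency value $l$ such that $X(S)$ is Ramanujan for every Cayley subset $S$ with $l(S)\le l$. *)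

theory Defs
  imports Complex_Main "HOL-Algebra.Elementary_Groups"
begin

(* Z/mZ is integer_mod_group m, with carrier {0..<int m} for m > 0; it is the additive group
   written multiplicatively, so its unit is 0 and its inverse is negation mod m. *)

definition cayley_subset :: "nat \<Rightarrow> int set \<Rightarrow> bool" where
  "cayley_subset m S \<longleftrightarrow>
     S \<subseteq> carrier (integer_mod_group m) \<and>
     \<one>\<^bsub>integer_mod_group m\<^esub> \<notin> S \<and>
     m_inv (integer_mod_group m) ` S = S \<and>
     generate (integer_mod_group m) S = carrier (integer_mod_group m)"

definition cayley_adj :: "nat \<Rightarrow> int set \<Rightarrow> int \<Rightarrow> int \<Rightarrow> bool" where
  "cayley_adj m S x y \<longleftrightarrow>
     x \<in> carrier (integer_mod_group m) \<and> y \<in> carrier (integer_mod_group m) \<and>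
     y \<otimes>\<^bsub>integer_mod_group m\<^esub> m_inv (integer_mod_group m) x \<in> S"

definition cayley_eigenvalue :: "nat \<Rightarrow> int set \<Rightarrow> nat \<Rightarrow> complex" where
  "cayley_eigenvalue m S j =
     (\<Sum>a\<in>S. exp (2 * of_real pi * \<i> * of_int a * of_nat j / of_nat m))"

definition cayley_mu :: "nat \<Rightarrow> int set \<Rightarrow> real" where
  "cayley_mu m S = Max ((\<lambda>j. cmod (cayley_eigenvalue m S j)) ` {1..m - 1})"

definition ramanujan :: "nat \<Rightarrow> int set \<Rightarrow> bool" where
  "ramanujan m S \<longleftrightarrow> cayley_mu m S \<le> 2 * sqrt (real (card S) - 1)"

definition covalency :: "nat \<Rightarrow> int set \<Rightarrow> nat" where
  "covalency m S = m - card S"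

definition l_hat :: "nat \<Rightarrow> nat" where
  "l_hat m = Max {l. (\<exists>S. cayley_subset m S \<and> covalency m S = l) \<and>
                     (\<forall>S. cayley_subset m S \<and> covalency m S \<le> l \<longrightarrow> ramanujan m S)}"

definition l_zero :: "nat \<Rightarrow> int" where
  "l_zero m = 2 * \<lfloor>sqrt (real m) - 3 / 2\<rfloor> + 1"

lemma exp_character_mod:
  assumes "m > 0"
  shows "exp (2 * of_real pi * \<i> * of_int (a mod int m) * of_nat j / of_nat m) =
         exp (2 * of_real pi * \<i> * of_int a * of_nat j / of_nat m :: complex)"
proof -
  have a: "a = a mod int m + int m * (a div int m)" by simp
  have "(of_int a :: complex) = of_int (a mod int m) + of_nat m * of_int (a div int m)"
    by (subst a, simp only: of_int_add of_int_mult of_int_of_nat_eq)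
  then have eq: "2 * of_real pi * \<i> * of_int a * of_nat j / of_nat m =
      2 * of_real pi * \<i> * of_int (a mod int m) * of_nat j / of_nat m +
      (2 * of_real pi * \<i> * of_int (a div int m * int j) :: complex)"
    using assms by (simp add: field_simps)
  have per: "exp (2 * of_real pi * \<i> * of_int k) = (1::complex)" for k :: int
  proof -
    have "exp (2 * of_real pi * \<i> * of_int k) = cis (2 * pi * real_of_int k)"
      by (simp add: cis_conv_exp algebra_simps)
    also have "\<dots> = 1" by simp
    finally show ?thesis .
  qed
  show ?thesis by (simp only: eq exp_add per mult_1_right)
qed

(* The numbers defined above are the eigenvalues of the adjacency operator of the Cayley graph:
   each character of Z/mZ is an eigenvector. *)
lemma cayley_eigenvalue_eigenvector:
  assumes m: "m > 0" and S: "S \<subseteq> carrier (integer_mod_group m)"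
    and x: "x \<in> carrier (integer_mod_group m)"
  shows "(\<Sum>y | cayley_adj m S x y. exp (2 * of_real pi * \<i> * of_int y * of_nat j / of_nat m)) =
         cayley_eigenvalue m S j * exp (2 * of_real pi * \<i> * of_int x * of_nat j / of_nat m)"
proof -
  let ?e = "\<lambda>a::int. exp (2 * of_real pi * \<i> * of_int a * of_nat j / of_nat m) :: complex"
  have car: "carrier (integer_mod_group m) = {0..<int m}"
    using m by (simp add: carrier_integer_mod_group)
  have adj: "cayley_adj m S x y \<longleftrightarrow> y \<in> {0..<int m} \<and> (y - x) mod int m \<in> S" for y
    using x m by (simp add: cayley_adj_def car mod_add_right_eq)
  have "(\<Sum>y | cayley_adj m S x y. ?e y) = (\<Sum>a\<in>S. ?e ((x + a) mod int m))"
    by (rule sum.reindex_bij_witness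
        [where i = "\<lambda>a. (x + a) mod int m" and j = "\<lambda>y. (y - x) mod int m"])
      (use S m in \<open>auto simp: adj car subset_iff mod_simps\<close>)
  also have "\<dots> = (\<Sum>a\<in>S. ?e a * ?e x)"
    using m by (simp only: exp_character_mod)
      (simp add: exp_add [symmetric] ring_distribs add_divide_distrib add.commute)
  finally show ?thesis
    by (simp add: cayley_eigenvalue_def sum_distrib_right)
qed

end

theory Submission
  imports Defs
begin

text \<open>
  A Cayley subset of covalency \<open>l\<close> has the same nontrivial eigenvalues, up to sign, as its
  complement, which has \<open>l\<close> elements; so they are at most \<open>l\<close> in modulus, and
  \<open>l \<le> 2 * sqrt (m - l - 1)\<close> amounts to \<open>(l + 2)\<^sup>2 \<le> 4 * m\<close>, whose largest odd solution is \<open>l\<^sub>0\<close>.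
  For \<open>l = l\<^sub>0 + 4\<close>, where \<open>2 * sqrt m < l \<le> 2 * sqrt m + 2\<close>, removing the interval of \<open>l\<close> elements
  centred at \<open>0\<close> gives an eigenvalue of modulus \<open>sin (pi * l / m) / sin (pi / m)\<close>, a Dirichlet kernel.
  By Taylor's formula this is close enough to \<open>l\<close> to exceed the Ramanujan bound. Covalencies are odd,
  because a Cayley subset splits into pairs \<open>{x, -x}\<close>.
\<close>

section \<open>Sine estimates\<close>

lemma sin_ge_cubic:
  fixes x :: real
  assumes "0 < x"
  shows "x - x ^ 3 / 6 \<le> sin x"
proof -
  obtain t where t: "sin x = (\<Sum>m<3. sin_coeff m * x ^ m) + (sin (t + 1/2 * real 3 * pi) / fact 3) * x ^ 3"
    using Maclaurin_sin_expansion[of x 3] by blast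
  have "sin (t + 1/2 * real 3 * pi) \<ge> -1"
    by (rule sin_ge_minus_one)
  then have "- (x ^ 3) \<le> sin (t + 1/2 * real 3 * pi) * x ^ 3"
    using assms mult_right_mono[of "-1" "sin (t + 1/2 * real 3 * pi)" "x ^ 3"] by simp
  then show ?thesis
    unfolding t by (simp add: eval_nat_numeral sin_coeff_def field_simps)
qed

text \<open>Taylor's formula with the degree 7 remainder bounded by \<open>x ^ 7 / 5040\<close>. The
  extra terms serve the numerical bound on \<open>pi\<close> and the smallest \<open>m\<close>,
  where the cubic estimate is too weak: it already fails for \<open>l = 9\<close>,
  \<open>m = 15\<close>.\<close>

lemma sin_ge_septic:
  fixes x :: real
  assumes "0 < x"
  shows "x - x ^ 3 / 6 + x ^ 5 / 120 - x ^ 7 / 5040 \<le> sin x"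
proof -
  obtain t where t: "sin x = (\<Sum>m<7. sin_coeff m * x ^ m) + (sin (t + 1/2 * real 7 * pi) / fact 7) * x ^ 7"
    using Maclaurin_sin_expansion[of x 7] by blast
  have sum: "(\<Sum>m<7. sin_coeff m * x ^ m) = x - x ^ 3 / 6 + x ^ 5 / 120"
  proof -
    have "{..<7} = {0, 1, 2, 3, 4, 5, 6 :: nat}"
      by auto
    then show ?thesis
      by (simp add: sin_coeff_def fact_numeral)
  qed
  have "sin (t + 1/2 * real 7 * pi) \<ge> -1"
    by (rule sin_ge_minus_one)
  then have "-1 * (x ^ 7 / 5040) \<le> sin (t + 1/2 * real 7 * pi) * (x ^ 7 / 5040)"
    using assms by (intro mult_right_mono) auto
  moreover have "fact 7 = (5040 :: real)"
    by (simp add: fact_numeral)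
  ultimately show ?thesis
    unfolding t sum by simp
qed

lemma pi_squared_less: "pi\<^sup>2 < 987 / 100"
proof -
  have "pi < 31416 / 10000"
  \<comment> \<open>\<open>5236 / 10000\<close> is a sixth of the claimed bound. Since sin (pi/6) =
    1/2 and the sine increases there, it is enough that its value at this point exceeds 1/2.\<close>
  proof (rule ccontr)
    assume "\<not> ?thesis"
    then have "sin (5236 / 10000) \<le> sin (pi / 6)"
      by (intro sin_monotone_2pi_le) (use pi_gt_zero in linarith)+
    moreover have "sin (5236 / 10000 :: real) > 1 / 2"
      by (rule less_le_trans[OF _ sin_ge_septic]) (simp_all add: power_divide)
    ultimately show False
      by (simp add: sin_30)
  qed
  then have "pi\<^sup>2 < (31416 / 10000)\<^sup>2"
    by (intro power_strict_mono) auto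
  then show ?thesis
    by (simp add: power_divide)
qed

text \<open>With x = pi l / m and y = x^2, the estimate sin x \<ge> x (1 - y/6) reduces the claim to
  2 sqrt (m - l - 1) < l (1 - y/6). After squaring, it is measured by the ratio r = l^2 / (4m),
  which exceeds 1 only slightly.\<close>

lemma sin_multiple_gt_of_cubic:
  fixes l m :: real
  assumes l: "l \<ge> 13" and lo: "(l - 2)\<^sup>2 \<le> 4 * m" and hi: "4 * m < l\<^sup>2"
  shows "2 * sqrt (m - l - 1) * (pi / m) < sin (pi * l / m)"
proof -
  have "(13 - 2)\<^sup>2 \<le> (l - 2)\<^sup>2"
    using l by (intro power_mono) auto
  with lo have m: "m \<ge> 121 / 4"
    by simp
  define r where "r = l\<^sup>2 / (4 * m)"
  define y where "y = (pi * l / m)\<^sup>2"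
  have r1: "r > 1"
    using hi m by (simp add: r_def)
  \<comment> \<open>The quotient l / (l - 2) is largest at \<open>l = 13\<close>; its square there,
    169/121, bounds \<open>r\<close>.\<close>
  have "11 * l \<le> 13 * (l - 2)"
    using l by simp
  then have "(11 * l)\<^sup>2 \<le> (13 * (l - 2))\<^sup>2"
    using l by (intro power_mono) auto
  also have "\<dots> \<le> 169 * (4 * m)"
    using lo by (simp only: power_mult_distrib) simp
  finally have r2: "r \<le> 169 / 121"
    using m by (simp add: r_def field_simps)
  have y: "y = pi\<^sup>2 * (4 * r / m)"
    using m by (simp add: y_def r_def power2_eq_square field_simps)
  have ry: "4 * r / m > 0"
    using r1 m by simp
  have "4 * r / m \<le> (4 * (169 / 121)) / (121 / 4)"
    using r1 r2 m by (intro frac_le) auto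
  then have "y \<le> (987 / 100) * ((4 * (169 / 121)) / (121 / 4))"
    unfolding y using pi_squared_less ry by (intro mult_mono) auto
  then have y6: "y < 6"
    by simp
  have lr: "l\<^sup>2 = 4 * m * r"
    using m by (simp add: r_def)
  have "y * l\<^sup>2 = pi\<^sup>2 * (16 * r\<^sup>2)"
    unfolding y lr using m by (simp add: power2_eq_square)
  also have "\<dots> \<le> 987 / 100 * (16 * r\<^sup>2)"
    using pi_squared_less by (intro mult_right_mono) auto
  finally have yl: "y * l\<^sup>2 \<le> 15792 / 100 * r\<^sup>2"
    by simp
  \<comment> \<open>The difference of the two sides is concave in \<open>r\<close>, so it suffices to bound \<open>r ^ 3\<close> by its chord over \<open>[1, 169/121]\<close>.\<close>
  have cubic: "169 * (r - 1) + 56 * r > 5264 / 100 * r ^ 3"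
  proof -
    have "r\<^sup>2 \<le> (169 / 121)\<^sup>2"
      using r1 r2 by (intro power_mono) auto
    then have "r\<^sup>2 + r + 1 \<le> (169 / 121)\<^sup>2 + 169 / 121 + 1"
      using r2 by simp
    then have "(r - 1) * (r\<^sup>2 + r + 1) \<le> (r - 1) * ((169 / 121)\<^sup>2 + 169 / 121 + 1)"
      using r1 by (intro mult_left_mono) auto
    moreover have "(r - 1) * (r\<^sup>2 + r + 1) = r ^ 3 - 1"
      by algebra
    ultimately show ?thesis
      using r1 r2 by (simp add: power_divide)
  qed
  \<comment> \<open>The constants in \<open>cubic\<close> are 169 = 13^2, 56 = 4 * 13 + 4 and a
    third of 15792/100 from \<open>yl\<close>. As l^2 = 4 m r, the term l^2 (r - 1) equals (l^2 -
    4m) r, so that a factor \<open>r\<close> can be cancelled.\<close>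
  have "l\<^sup>2 \<ge> 13\<^sup>2"
    using l by (intro power_mono) auto
  then have "169 * (r - 1) \<le> l\<^sup>2 * (r - 1)"
    using r1 by (intro mult_right_mono) simp_all
  moreover have "56 * r \<le> (4 * l + 4) * r"
    using l r1 by (intro mult_right_mono) simp_all
  ultimately have "l\<^sup>2 * (r - 1) + (4 * l + 4) * r > 5264 / 100 * r ^ 3"
    using cubic by linarith
  then have "(l\<^sup>2 + 4 * l + 4 - 4 * m - 5264 / 100 * r\<^sup>2) * r > 0"
    unfolding lr by (simp add: algebra_simps power2_eq_square power3_eq_cube)
  then have main: "l\<^sup>2 - y * l\<^sup>2 / 3 > 4 * (m - l - 1)"
    using r1 yl by (simp add: zero_less_mult_iff)
  \<comment> \<open>The added nonnegative term completes the square.\<close>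
  have "4 * (m - l - 1) < l\<^sup>2 - y * l\<^sup>2 / 3 + l\<^sup>2 * (y / 6)\<^sup>2"
    using main by (smt (verit) mult_nonneg_nonneg zero_le_power2)
  also have "\<dots> = (l * (1 - y / 6))\<^sup>2"
    by (simp add: power2_eq_square field_simps)
  finally have "sqrt (4 * (m - l - 1)) < l * (1 - y / 6)"
    using l y6 by (intro real_less_lsqrt) auto
  then have "2 * sqrt (m - l - 1) < l * (1 - y / 6)"
    by (simp only: real_sqrt_mult real_sqrt_four)
  then have "2 * sqrt (m - l - 1) * (pi / m) < l * (1 - y / 6) * (pi / m)"
    using m by (intro mult_strict_right_mono) auto
  also have "l * (1 - y / 6) * (pi / m) = pi * l / m * (1 - (pi * l / m)\<^sup>2 / 6)"
    by (simp add: y_def)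
  also have "\<dots> = pi * l / m - (pi * l / m) ^ 3 / 6"
    by (simp add: right_diff_distrib flip: power_Suc)
  also have "\<dots> \<le> sin (pi * l / m)"
    using l m by (intro sin_ge_cubic) auto
  finally show ?thesis .
qed

text \<open>Replacing pi^2 by 987/100 turns the hypotheses into rational arithmetic for concrete
  \<open>l\<close> and \<open>m\<close>. The replacement is safe because the Taylor polynomial of
  sin x / x, as a polynomial in y = x^2, decreases on [0, 10].\<close>

lemma sin_multiple_gt_of_septic:
  fixes l m :: real
  defines "Y \<equiv> 987 / 100 * (l / m)\<^sup>2"
  assumes l: "l > 0" and m: "m > 0" and Y: "Y \<le> 10"
    and bound: "4 * (m - l - 1) < (l * (1 - Y / 6 + Y\<^sup>2 / 120 - Y ^ 3 / 5040))\<^sup>2"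
    and pos: "1 - Y / 6 + Y\<^sup>2 / 120 - Y ^ 3 / 5040 > 0"
  shows "2 * sqrt (m - l - 1) * (pi / m) < sin (pi * l / m)"
proof -
  define p :: "real \<Rightarrow> real" where "p y = 1 - y / 6 + y\<^sup>2 / 120 - y ^ 3 / 5040" for y
  define y where "y = (pi * l / m)\<^sup>2"
  have y0: "y \<ge> 0"
    by (simp add: y_def)
  have "y = pi\<^sup>2 * (l / m)\<^sup>2"
    by (simp add: y_def power_mult_distrib power_divide)
  also have "\<dots> \<le> Y"
    unfolding Y_def using pi_squared_less by (intro mult_right_mono) auto
  finally have yY: "y \<le> Y" .
  have "p y - p Y = (Y - y) * (1 / 6 - (y + Y) / 120 + (y\<^sup>2 + y * Y + Y\<^sup>2) / 5040)"
    by (simp add: p_def power2_eq_square power3_eq_cube field_simps)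
  \<comment> \<open>From y \<le> Y \<le> 10 follows (y + Y) / 120 \<le> 1/6.\<close>
  moreover have "\<dots> \<ge> 0"
    using y0 yY Y by (intro mult_nonneg_nonneg add_nonneg_nonneg) auto
  ultimately have p: "p Y \<le> p y"
    by simp
  have "sqrt (4 * (m - l - 1)) < l * p Y"
    using l bound pos by (intro real_less_lsqrt) (auto simp: p_def)
  then have "2 * sqrt (m - l - 1) < l * p Y"
    by (simp only: real_sqrt_mult real_sqrt_four)
  also have "\<dots> \<le> l * p y"
    using l p by (intro mult_left_mono) auto
  finally have "2 * sqrt (m - l - 1) * (pi / m) < l * p y * (pi / m)"
    using m by (intro mult_strict_right_mono) auto
  also have "l * p y * (pi / m) = pi * l / m * p ((pi * l / m)\<^sup>2)"
    by (simp add: y_def)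
  also have "\<dots> = pi * l / m - (pi * l / m) ^ 3 / 6 + (pi * l / m) ^ 5 / 120 - (pi * l / m) ^ 7 / 5040"
    unfolding p_def by (simp add: right_diff_distrib distrib_left flip: power_mult power_Suc)
  also have "\<dots> \<le> sin (pi * l / m)"
    using l m by (intro sin_ge_septic) auto
  finally show ?thesis .
qed

text \<open>The hypotheses place l = 2k + 1 in the window l - 2 \<le> 2 sqrt m < l. The cubic
  estimate covers l \<ge> 13. Below that, m \<ge> 15 leaves only l = 9 and l = 11, with eight odd
  values of \<open>m\<close> to compute.\<close>

lemma sin_multiple_gt:
  fixes k m :: nat
  assumes "odd m" and "m \<ge> 15" and lo: "(2 * k - 1)\<^sup>2 \<le> 4 * m" and hi: "4 * m < (2 * k + 1)\<^sup>2"
  shows "2 * sqrt (real m - real (2 * k + 1) - 1) * (pi / m) < sin (pi * real (2 * k + 1) / m)"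
proof (cases "k \<ge> 6")
  case True
  have "(real (2 * k + 1) - 2)\<^sup>2 = real ((2 * k - 1)\<^sup>2)"
    using True by (simp add: of_nat_diff)
  also have "\<dots> \<le> 4 * real m"
    using lo by (simp flip: of_nat_le_iff[where ?'a = real])
  finally show ?thesis
    using True hi by (intro sin_multiple_gt_of_cubic) (simp_all flip: of_nat_less_iff[where ?'a = real])
next
  case False
  have "k \<ge> 4"
  proof (rule ccontr)
    assume "\<not> ?thesis"
    then have "(2 * k + 1)\<^sup>2 \<le> 7\<^sup>2"
      by (intro power_mono) auto
    with hi \<open>m \<ge> 15\<close> show False
      by simp
  qed
  with False consider "k = 4" | "k = 5"
    by linarith
  then show ?thesis
  proof cases
    case 1
    with hi \<open>odd m\<close> \<open>m \<ge> 15\<close> have "m = 15 \<or> m = 17 \<or> m = 19"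
      by simp presburger
    with 1 show ?thesis
      by (elim disjE; intro sin_multiple_gt_of_septic) (simp_all add: power_divide)
  next
    case 2
    with lo hi \<open>odd m\<close> have "m = 21 \<or> m = 23 \<or> m = 25 \<or> m = 27 \<or> m = 29"
      by simp presburger
    with 2 show ?thesis
      by (elim disjE; intro sin_multiple_gt_of_septic) (simp_all add: power_divide)
  qed
qed


section \<open>Cayley subsets and their eigenvalues\<close>

lemma cayley_subset_bounds:
  assumes "m > 0" and "cayley_subset m S"
  shows "S \<subseteq> {0<..<int m}"
proof
  fix x
  assume "x \<in> S"
  moreover have "S \<subseteq> {0..<int m}" "0 \<notin> S"
    using assms by (simp_all add: cayley_subset_def carrier_integer_mod_group)
  ultimately have "x \<in> {0..<int m}" "x \<noteq> 0"
    by auto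
  then show "x \<in> {0<..<int m}"
    by simp
qed

lemma cayley_subset_reflect:
  assumes m: "m > 0" and S: "cayley_subset m S" and x: "x \<in> S"
  shows "int m - x \<in> S"
proof -
  have x': "x \<in> {0<..<int m}"
    using cayley_subset_bounds[OF m S] x by blast
  have "m_inv (integer_mod_group m) x \<in> S"
    using S x unfolding cayley_subset_def by blast
  moreover have "m_inv (integer_mod_group m) x = int m - x"
    using x' by (simp add: carrier_integer_mod_group zmod_zminus1_eq_if)
  ultimately show ?thesis
    by simp
qed

lemma even_card_cayley_subset:
  assumes "odd m" and S: "cayley_subset m S"
  shows "even (card S)"
proof -
  have m: "m > 0"
    using assms by (simp add: odd_pos)
  \<comment> \<open>\<open>A\<close> takes the smaller member of each pair {x, m - x}; the two
    differ because \<open>m\<close> is odd.\<close>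
  define A where "A = {x \<in> S. 2 * x < int m}"
  have fin: "finite S"
    using cayley_subset_bounds[OF m S] finite_subset by blast
  have "x \<in> A \<or> int m - x \<in> A" if "x \<in> S" for x
  proof -
    have "2 * x \<noteq> int m"
      using \<open>odd m\<close> by presburger
    then show ?thesis
      using that cayley_subset_reflect[OF m S that] by (auto simp: A_def)
  qed
  then have "S = A \<union> (\<lambda>x. int m - x) ` A"
    using cayley_subset_reflect[OF m S] by (force simp: A_def)
  moreover have "A \<inter> (\<lambda>x. int m - x) ` A = {}"
    by (auto simp: A_def)
  moreover have "card ((\<lambda>x. int m - x) ` A) = card A"
    by (intro card_image) (auto simp: inj_on_def)
  moreover have "finite A"
    using fin by (simp add: A_def)
  ultimately have "card S = card A + card A"
    by (metis card_Un_disjoint finite_imageI)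
  then show ?thesis
    by simp
qed

text \<open>This is a full geometric sum in an \<open>m\<close>-th root of unity other than
  1.\<close>

lemma sum_characters_eq_0:
  assumes "0 < j" and "j < m"
  shows "(\<Sum>a\<in>{0..<int m}. exp (2 * of_real pi * \<i> * of_int a * of_nat j / of_nat m)) = (0 :: complex)"
proof -
  define z where "z = cis (2 * pi * real j / real m)"
  have "z \<noteq> 1"
  proof
    assume "z = 1"
    then have "cos (2 * pi * real j / real m) = 1"
      by (metis z_def cis.sel(1) one_complex.sel(1))
    then obtain n :: int where "2 * pi * real j / real m = n * 2 * pi"
      by (auto simp: cos_one_2pi_int)
    then have "real j = real_of_int n * real m"
      using assms by (simp add: field_simps)
    then have j: "int j = n * int m"
      by (metis of_int_eq_iff of_int_mult of_int_of_nat_eq)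
    then have "int m dvd int j"
      by simp
    then show False
      using assms by (auto dest: dvd_imp_le)
  qed
  moreover have "z ^ m = 1"
    using assms by (simp add: z_def DeMoivre cis_multiple_2pi)
  ultimately have "(\<Sum>a<m. z ^ a) = 0"
    by (simp add: geometric_sum)
  moreover have "{0..<int m} = int ` {..<m}"
    by (simp add: image_int_atLeastLessThan lessThan_atLeast0)
  moreover have "exp (2 * of_real pi * \<i> * of_int (int a) * of_nat j / of_nat m) = z ^ a" for a
    unfolding z_def DeMoivre unfolding cis_conv_exp by (simp add: mult_ac)
  ultimately show ?thesis
    by (simp add: sum.reindex)
qed

text \<open>The character sums to 0 over the whole group, so the eigenvalue is minus a sum of
  \<open>m - card S\<close> terms of modulus 1.\<close>

lemma norm_cayley_eigenvalue_le:
  assumes "0 < j" and "j < m" and S: "S \<subseteq> {0..<int m}"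
  shows "cmod (cayley_eigenvalue m S j) \<le> real (m - card S)"
proof -
  let ?e = "\<lambda>a::int. exp (2 * of_real pi * \<i> * of_int a * of_nat j / of_nat m) :: complex"
  have e: "cmod (?e a) = 1" for a
    by (simp add: norm_exp_eq_Re)
  have "(\<Sum>a\<in>{0..<int m} - S. ?e a) + (\<Sum>a\<in>S. ?e a) = 0"
    using sum.subset_diff[of S "{0..<int m}" ?e] S sum_characters_eq_0[OF assms(1,2)] by simp
  then have "cayley_eigenvalue m S j = - (\<Sum>a\<in>{0..<int m} - S. ?e a)"
    unfolding cayley_eigenvalue_def using eq_neg_iff_add_eq_0 by (metis add.commute)
  then have "cmod (cayley_eigenvalue m S j) \<le> (\<Sum>a\<in>{0..<int m} - S. cmod (?e a))"
    by (simp only: norm_minus_cancel norm_sum)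
  also have "\<dots> = real (m - card S)"
    using card_Diff_subset[OF finite_subset[OF S] S] by (simp add: e)
  finally show ?thesis .
qed

lemma ramanujan_if_small_covalency:
  assumes m: "m \<ge> 2" and S: "cayley_subset m S" and l: "(covalency m S + 2)\<^sup>2 \<le> 4 * m"
  shows "ramanujan m S"
proof -
  let ?l = "covalency m S"
  have sub: "S \<subseteq> {0..<int m}"
    using cayley_subset_bounds[OF _ S] m by fastforce
  have "card S \<le> card {0..<int m}"
    by (intro card_mono sub) auto
  then have card: "real (card S) = real m - real ?l"
    by (simp add: covalency_def)
  have "(real ?l + 2)\<^sup>2 = real ((?l + 2)\<^sup>2)"
    by simp
  also have "\<dots> \<le> real (4 * m)"
    using l of_nat_mono by blast
  \<comment> \<open>Completing the square, l^2 \<le> 4 (m - l - 1) says (l + 2)^2 \<le> 4m.\<close>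
  finally have "(real ?l)\<^sup>2 \<le> 4 * (real (card S) - 1)"
    unfolding card by (simp add: power2_eq_square algebra_simps)
  then have "real ?l \<le> sqrt (4 * (real (card S) - 1))"
    by (rule real_le_rsqrt)
  also have "\<dots> = 2 * sqrt (real (card S) - 1)"
    by (simp only: real_sqrt_mult real_sqrt_four)
  finally have "real ?l \<le> 2 * sqrt (real (card S) - 1)" .
  moreover have "cmod (cayley_eigenvalue m S j) \<le> real ?l" if "j \<in> {1..m - 1}" for j
    unfolding covalency_def using that m by (intro norm_cayley_eigenvalue_le sub) auto
  ultimately show ?thesis
    unfolding ramanujan_def cayley_mu_def using m by (subst Max_le_iff) force+
qed

section \<open>Intervals as Cayley subsets\<close>

text \<open>In the representatives 0, ..., m - 1 this is the complement of the residues -k, ...,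
  k.\<close>

definition middle_interval :: "nat \<Rightarrow> nat \<Rightarrow> int set" where
  "middle_interval m k = {int k + 1..int m - int k - 1}"

lemma card_middle_interval:
  assumes "2 * k + 1 \<le> m"
  shows "card (middle_interval m k) = m - (2 * k + 1)"
  using assms by (simp add: middle_interval_def nat_diff_distrib')

lemma covalency_middle_interval:
  assumes "2 * k + 1 \<le> m"
  shows "covalency m (middle_interval m k) = 2 * k + 1"
  using assms by (simp add: covalency_def card_middle_interval)

text \<open>The interval is symmetric under x \<mapsto> m - x, and the hypothesis leaves it at least
  two consecutive elements, whose difference generates the group.\<close>

lemma cayley_subset_middle_interval:
  assumes k: "2 * k + 3 \<le> m"
  shows "cayley_subset m (middle_interval m k)"
proof -
  let ?G = "integer_mod_group m" and ?S = "middle_interval m k"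
  have m: "m > 0"
    using k by simp
  have car: "carrier ?G = {0..<int m}"
    using m by (simp add: carrier_integer_mod_group)
  have sub: "?S \<subseteq> carrier ?G"
    by (auto simp: car middle_interval_def)
  have inv: "m_inv ?G x = int m - x" if "x \<in> ?S" for x
    using that sub by (simp add: carrier_integer_mod_group zmod_zminus1_eq_if middle_interval_def subset_iff)
  have "m_inv ?G ` ?S = (\<lambda>x. int m - x) ` ?S"
    using inv by (intro image_cong) auto
  also have "\<dots> = ?S"
    by (simp add: middle_interval_def)
  finally have sym: "m_inv ?G ` ?S = ?S" .
  have H: "subgroup (generate ?G ?S) ?G"
    by (intro group.generate_is_subgroup sub) simp
  \<comment> \<open>\<open>1\<close> is the difference of the two consecutive elements \<open>k + 2\<close> and \<open>k + 1\<close>.\<close>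
  have "(int k + 2) \<otimes>\<^bsub>?G\<^esub> m_inv ?G (int k + 1) \<in> generate ?G ?S"
    using k by (intro generate.eng generate.incl generate.inv) (auto simp: middle_interval_def)
  moreover have "m_inv ?G (int k + 1) = int m - (int k + 1)"
    using k by (intro inv) (simp add: middle_interval_def)
  ultimately have "(int k + 2 + (int m - (int k + 1))) mod int m \<in> generate ?G ?S"
    by (simp only: mult_integer_mod_group)
  moreover have "int k + 2 + (int m - (int k + 1)) = 1 + int m"
    by simp
  ultimately have "(1 + int m) mod int m \<in> generate ?G ?S"
    by (simp only:)
  then have one: "1 \<in> generate ?G ?S"
    using k by simp
  have "x \<in> generate ?G ?S" if "x \<in> carrier ?G" for x
  proof -
    have "1 [^]\<^bsub>?G\<^esub> nat x \<in> generate ?G ?S"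
      using one H by (metis group.subgroup_int_pow_closed group_integer_mod_group int_pow_int)
    then show ?thesis
      using that by (simp add: car)
  qed
  then have "generate ?G ?S = carrier ?G"
    using group.generate_incl[OF _ sub] by auto
  then show ?thesis
    using sub sym by (auto simp: cayley_subset_def middle_interval_def)
qed

text \<open>Multiplied by 2 i sin (pi/m), the sum of roots of unity telescopes in the half-step
  points \<open>f n\<close>. Keeping the sine as a factor avoids a division.\<close>

lemma cayley_eigenvalue_middle_interval:
  assumes k: "2 * k + 1 \<le> m"
  shows "sin (pi / m) * cayley_eigenvalue m (middle_interval m k) 1 = - sin (pi * real (2 * k + 1) / m)"
proof -
  define f where "f n = cis (2 * pi * (real n + 1 / 2) / m)" for n :: nat
  have m: "m > 0"
    using k by simp
  have "middle_interval m k = int ` {Suc k..m - Suc k}"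
    using k by (simp add: middle_interval_def image_int_atLeastAtMost)
  then have ev: "cayley_eigenvalue m (middle_interval m k) 1 = (\<Sum>n = Suc k..m - Suc k. cis (2 * pi * real n / m))"
    by (simp add: cayley_eigenvalue_def sum.reindex cis_conv_exp mult_ac)
  have step: "2 * \<i> * sin (pi / m) * cis (2 * pi * real n / m) = f n - f (n - 1)" if "n \<ge> 1" for n
  proof -
    have "f n = cis (2 * pi * real n / m) * cis (pi / m)"
      unfolding f_def cis_mult using m by (intro arg_cong[where f = cis]) (simp add: field_simps)
    moreover have "f (n - 1) = cis (2 * pi * real n / m) * cis (- (pi / m))"
      unfolding f_def cis_mult using m that by (intro arg_cong[where f = cis]) (simp add: field_simps)
    moreover have "cis (pi / m) - cis (- (pi / m)) = 2 * \<i> * sin (pi / m)"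
      by (simp add: complex_eq_iff)
    ultimately show ?thesis
      by (metis (no_types, lifting) mult.commute right_diff_distrib)
  qed
  have "2 * \<i> * sin (pi / m) * cayley_eigenvalue m (middle_interval m k) 1
      = (\<Sum>n = Suc k..m - Suc k. f n - f (n - 1))"
    unfolding ev sum_distrib_left by (intro sum.cong refl step) auto
  also have "\<dots> = f (m - Suc k) - f k"
    using k by (intro sum_telescope'') auto
  \<comment> \<open>The angle 2 pi (m - k - 1/2) / m is a full turn minus that of
    \<open>f k\<close>, so the end points are conjugate.\<close>
  also have "f (m - Suc k) = cis (2 * pi) * cis (- (pi * real (2 * k + 1) / m))"
    unfolding f_def cis_mult using k m by (intro arg_cong[where f = cis]) (simp add: field_simps)
  also have "f k = cis (pi * real (2 * k + 1) / m)"
    unfolding f_def using m by (intro arg_cong[where f = cis]) (simp add: field_simps)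
  also have "cis (2 * pi) * cis (- (pi * real (2 * k + 1) / m)) - cis (pi * real (2 * k + 1) / m)
      = 2 * \<i> * - sin (pi * real (2 * k + 1) / m)"
    by (simp add: complex_eq_iff)
  finally have "2 * \<i> * (sin (pi / m) * cayley_eigenvalue m (middle_interval m k) 1)
      = 2 * \<i> * - sin (pi * real (2 * k + 1) / m)"
    by (simp only: mult.assoc)
  then show ?thesis
    by (subst (asm) mult_cancel_left) simp
qed

text \<open>The single eigenvalue at j = 1 suffices: the Ramanujan bound times sin (pi/m) \<le> pi/m
  would contradict \<open>sin_multiple_gt\<close>.\<close>

lemma not_ramanujan_middle_interval:
  assumes "odd m" and "m \<ge> 15" and k: "2 * k + 1 < m"
    and "(2 * k - 1)\<^sup>2 \<le> 4 * m" and "4 * m < (2 * k + 1)\<^sup>2"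
  shows "\<not> ramanujan m (middle_interval m k)"
proof
  let ?e = "cmod (cayley_eigenvalue m (middle_interval m k) 1)"
  let ?b = "2 * sqrt (real m - real (2 * k + 1) - 1)"
  assume "ramanujan m (middle_interval m k)"
  moreover have "?e \<le> cayley_mu m (middle_interval m k)"
    unfolding cayley_mu_def using \<open>m \<ge> 15\<close> by (intro Max_ge) auto
  ultimately have e: "?e \<le> ?b"
    using k by (simp add: ramanujan_def card_middle_interval of_nat_diff)
  have s: "0 \<le> sin (pi / m)" "sin (pi / m) \<le> pi / m"
    using \<open>m \<ge> 15\<close> by (auto intro!: sin_ge_zero sin_x_le_x simp: divide_le_eq)
  have "sin (pi * real (2 * k + 1) / m) \<le> \<bar>sin (pi * real (2 * k + 1) / m)\<bar>"
    by simp
  also have "\<dots> = cmod (sin (pi / m) * cayley_eigenvalue m (middle_interval m k) 1)"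
    using k by (subst cayley_eigenvalue_middle_interval) auto
  also have "\<dots> = ?e * sin (pi / m)"
    using s by (simp add: norm_mult)
  also have "\<dots> \<le> ?b * (pi / m)"
    by (intro mult_mono e s order_trans[OF norm_ge_zero e])
  also have "\<dots> < sin (pi * real (2 * k + 1) / m)"
    using assms by (intro sin_multiple_gt) auto
  finally show False
    by simp
qed

section \<open>The extremal covalency\<close>

theorem theorem3p3:
  fixes m :: nat
  assumes "m \<ge> 15" and "odd m"
  shows "\<exists>\<epsilon>\<in>{0, 2}. int (l_hat m) = l_zero m + \<epsilon>"
proof -
  define K where "K = nat \<lfloor>sqrt (real m) - 3 / 2\<rfloor>"
  define L where "L = {l. (\<exists>S. cayley_subset m S \<and> covalency m S = l) \<and>
                     (\<forall>S. cayley_subset m S \<and> covalency m S \<le> l \<longrightarrow> ramanujan m S)}"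
  \<comment> \<open>The floor is therefore nonnegative, and \<open>nat\<close> in the definition of
    \<open>K\<close> loses nothing.\<close>
  have "sqrt (real m) \<ge> 7 / 2"
    using \<open>m \<ge> 15\<close> by (intro real_le_rsqrt) (simp add: power_divide)
  then have fl: "\<lfloor>sqrt (real m) - 3 / 2\<rfloor> = int K"
    by (simp add: K_def le_floor_iff)
  have l0: "l_zero m = int (2 * K + 1)"
    by (simp add: l_zero_def fl)
  have "real K \<le> sqrt (real m) - 3 / 2" and "sqrt (real m) - 3 / 2 < real K + 1"
    using fl by (simp_all add: floor_eq_iff)
  then have "real (2 * K + 3) \<le> sqrt (4 * real m)" and "sqrt (4 * real m) < real (2 * K + 5)"
    by (simp_all add: real_sqrt_mult)
  then have "(real (2 * K + 3))\<^sup>2 \<le> (sqrt (4 * real m))\<^sup>2" and "(sqrt (4 * real m))\<^sup>2 < (real (2 * K + 5))\<^sup>2"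
    by (auto intro!: power_mono power_strict_mono simp del: real_sqrt_pow2)
  then have "real ((2 * K + 3)\<^sup>2) \<le> real (4 * m)" and "real (4 * m) < real ((2 * K + 5)\<^sup>2)"
    by (simp_all only: real_sqrt_pow2[of "4 * real m"] of_nat_power of_nat_mult of_nat_numeral)
  then have lo: "(2 * K + 3)\<^sup>2 \<le> 4 * m" and hi: "4 * m < (2 * K + 5)\<^sup>2"
    by (simp_all only: of_nat_le_iff of_nat_less_iff)
  have Km: "2 * K + 5 < m"
  proof (rule ccontr)
    assume neg: "\<not> ?thesis"
    with \<open>m \<ge> 15\<close> have "(2 * K + 3) * 13 \<le> (2 * K + 3)\<^sup>2"
      unfolding power2_eq_square by (intro mult_left_mono) auto
    then have "(2 * K + 3) * 13 \<le> 4 * m"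
      using lo by (rule order_trans)
    with neg show False
      by simp
  qed
  have lower: "2 * K + 1 \<in> L"
  proof -
    have "ramanujan m S" if "cayley_subset m S" "covalency m S \<le> 2 * K + 1" for S
    proof (rule ramanujan_if_small_covalency)
      have "(covalency m S + 2)\<^sup>2 \<le> (2 * K + 3)\<^sup>2"
        using that by (intro power_mono) auto
      then show "(covalency m S + 2)\<^sup>2 \<le> 4 * m"
        using lo by (rule order_trans)
    qed (use that \<open>m \<ge> 15\<close> in auto)
    moreover have "cayley_subset m (middle_interval m K)" "covalency m (middle_interval m K) = 2 * K + 1"
      using Km by (simp_all add: cayley_subset_middle_interval covalency_middle_interval)
    ultimately show ?thesis
      unfolding L_def mem_Collect_eq by (intro conjI exI[of _ "middle_interval m K"]) auto
  qed
  have upper: "odd l \<and> l < 2 * K + 5" if "l \<in> L" for l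
  proof
    obtain S where S: "cayley_subset m S" "covalency m S = l"
      using \<open>l \<in> L\<close> by (auto simp: L_def)
    have "S \<subseteq> {0..<int m}"
      using cayley_subset_bounds[OF _ S(1)] \<open>m \<ge> 15\<close> by fastforce
    then have "card S \<le> card {0..<int m}"
      by (intro card_mono) auto
    then show "odd l"
      using even_card_cayley_subset[OF \<open>odd m\<close> S(1)] \<open>odd m\<close> by (simp add: S(2)[symmetric] covalency_def)
    have "\<not> ramanujan m (middle_interval m (K + 2))"
    proof (rule not_ramanujan_middle_interval)
      have "2 * (K + 2) - 1 = 2 * K + 3" "2 * (K + 2) + 1 = 2 * K + 5"
        by simp_all
      then show "(2 * (K + 2) - 1)\<^sup>2 \<le> 4 * m" "4 * m < (2 * (K + 2) + 1)\<^sup>2" "2 * (K + 2) + 1 < m"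
        using lo hi Km by (simp_all only:)
    qed (use assms in auto)
    \<comment> \<open>The required 2K + 7 \<le> m follows from 2K + 5 < m, as both sides are
      odd.\<close>
    moreover have "cayley_subset m (middle_interval m (K + 2))"
      using Km \<open>odd m\<close> by (intro cayley_subset_middle_interval) presburger
    moreover have "covalency m (middle_interval m (K + 2)) = 2 * K + 5"
      using Km by (subst covalency_middle_interval) auto
    \<comment> \<open>A larger \<open>l\<close> in \<open>L\<close> would force this interval to be
      Ramanujan.\<close>
    ultimately show "l < 2 * K + 5"
      using \<open>l \<in> L\<close> unfolding L_def by (auto simp: not_le[symmetric])
  qed
  have fin: "finite L"
    using upper by (intro finite_subset[of L "{..<2 * K + 5}"]) auto
  have "Max L \<in> L"
    using lower by (intro Max_in fin) auto
  then have "odd (Max L)" and "Max L < 2 * K + 5"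
    by (simp_all add: upper)
  moreover have "2 * K + 1 \<le> Max L"
    by (intro Max_ge fin lower)
  ultimately have "Max L = 2 * K + 1 \<or> Max L = 2 * K + 3"
    by presburger
  moreover have "l_hat m = Max L"
    by (simp add: l_hat_def L_def)
  ultimately show ?thesis
    by (auto simp: l0)
qed

end
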